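(* Let $0<R<1$, $0<\mu\le 1-R$ with $(1-R)/\mu$ an integer, and $0\le\ell\le1$. Then the asymptotic growth rate $\sigma_\ell(R,\mu)$ of the redundant random ensembles satisfies $$\sigma_\ell(R,\mu)\ \le\ \begin{cases}H(\ell)-(1-R)\left(1-\dfrac{\ell}{\mu}\right), & \ell\le\mu,\\[2mm] H(\ell), & \ell>\mu.\end{cases}$$
   Context: $H(x)=-x\log_2x-(1-x)\log_2(1-x)$ is the binary entropy function (with $0\log_2 0=0$). For $h,x\in\{0,1\}^n$ let $h\circ x=\sum_i h_ix_i$, computed in the integers. For a binary matrix $M$ with $n$ columns, $x\in\{0,1\}^n$ is a stopping set (SS) vector of $M$ if no row $h$ of $M$ satisfies $h\circ x=1$. $S_w(M)$ is the number of SS vectors of $M$ of Hamming weight $w$. Redundant extension: for a binary $m\times n$ matrix $G$ ($1\le m<n$) and a positive divisor $L$ of $m$, partition the rows into $m/L$ consecutive blocks of $L$ rows; $G^{(L)}$ is the $(2^L-1)(m/L)\times n$ matrix whose rows are, for each block, all $2^L-1$ linear combinations over $F_2$ of its $L$ rows with nonzero coefficient vector. $\mathcal R_{m,n}$ is the set of all $2^{mn}$ binary $m\times n$ matrices, and the redundant random ensemble $\mathcal R_{m,n}^{(L)}$ is the family $\{G^{(L)}:G\in\mathcal R_{m,n}\}$ with uniform probability $2^{-mn}$ on the index $G$; its average SS weight distribution is $S_w^{\mathcal R_{m,n}^{(L)}}=2^{-mn}\sum_{G\in\mathcal R_{m,n}}S_w(G^{(L)})$ for $0\le w\le n$. For $0\le\ell\le1$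 and $0<\mu\le 1-R$, the asymptotic growth rate is $$\sigma_\ell(R,\mu)=\lim_{n\to\infty}\frac1n\log_2 S_{\ell n}^{\mathcal R_{(1-R)n,n}^{(\mu n)}},$$ where $R$ is the design rate, $\ell$ the normalized weight and $\mu$ the normalized extension degree; it is well defined only if $(1-R)/\mu$ is an integer. The limit is understood over those $n$ for which $(1-R)n$, $\mu n$ and $\ell n$ are integers.
   Formalization: The case ℓ=0 is excluded: the zero vector is always a stopping set vector, so σ_0(R,μ)=0, while the claimed bound there is −(1−R)<0; the result is stated for 0<ℓ≤1. *)

theory Defs
  imports
    "Jordan_Normal_Form.Matrix"
    "HOL-Library.Z2"
    "HOL-Library.Extended_Real"
begin

definition binary_entropy :: "real \<Rightarrow> real" where
  "binary_entropy x = - x * log 2 x - (1 - x) * log 2 (1 - x)"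

text \<open>The convention for \<open>0 * log 0\<close> is automatic, as \<open>log 2 0 = 0\<close>.\<close>

lemma binary_entropy_0 [simp]: "binary_entropy 0 = 0"
  by (simp add: binary_entropy_def)

definition int_inner :: "bit vec \<Rightarrow> bit vec \<Rightarrow> int" where
  "int_inner h x = (\<Sum>i<dim_vec x. of_bit (h $ i) * of_bit (x $ i))"

definition stopping_set_vec :: "bit mat \<Rightarrow> bit vec \<Rightarrow> bool" where
  "stopping_set_vec M x \<longleftrightarrow>
     x \<in> carrier_vec (dim_col M) \<and> \<not> (\<exists>h \<in> set (rows M). int_inner h x = 1)"

definition hamming_weight :: "bit vec \<Rightarrow> nat" where
  "hamming_weight x = card {i. i < dim_vec x \<and> x $ i \<noteq> 0}"

definition num_stopping :: "nat \<Rightarrow> bit mat \<Rightarrow> nat" where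
  "num_stopping w M = card {x. stopping_set_vec M x \<and> hamming_weight x = w}"

definition coeff_vecs :: "nat \<Rightarrow> bit list list" where
  "coeff_vecs L = filter (\<lambda>c. c \<noteq> replicate L 0) (List.n_lists L [0, 1])"

definition block_comb :: "nat \<Rightarrow> bit mat \<Rightarrow> nat \<Rightarrow> bit list \<Rightarrow> bit vec" where
  "block_comb L G b c = vec (dim_col G) (\<lambda>j. \<Sum>k<L. c ! k * G $$ (b * L + k, j))"

definition redundant_ext :: "nat \<Rightarrow> bit mat \<Rightarrow> bit mat" where
  "redundant_ext L G = mat_of_rows (dim_col G)
     (concat (map (\<lambda>b. map (block_comb L G b) (coeff_vecs L)) [0..<dim_row G div L]))"

text \<open>The average runs over the index matrix \<open>G\<close>, so extensions arising from several \<open>G\<close>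
  are counted with multiplicity.\<close>

definition avg_num_stopping :: "nat \<Rightarrow> nat \<Rightarrow> nat \<Rightarrow> nat \<Rightarrow> real" where
  "avg_num_stopping m n L w =
     (\<Sum>G \<in> carrier_mat m n. real (num_stopping w (redundant_ext L G))) / 2 ^ (m * n)"

definition admissible_lengths :: "real \<Rightarrow> real \<Rightarrow> real \<Rightarrow> nat set" where
  "admissible_lengths R \<mu> l =
     {n. (1 - R) * real n \<in> \<nat> \<and> \<mu> * real n \<in> \<nat> \<and> l * real n \<in> \<nat>}"

text \<open>The floors below are exact on admissible lengths, the only ones that enter the limit.\<close>

definition growth_seq :: "real \<Rightarrow> real \<Rightarrow> real \<Rightarrow> nat \<Rightarrow> real" where
  "growth_seq R \<mu> l n =
     log 2 (avg_num_stopping (nat \<lfloor>(1 - R) * real n\<rfloor>) n (nat \<lfloor>\<mu> * real n\<rfloor>) (nat \<lfloor>l * real n\<rfloor>))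
       / real n"

definition admissible_filter :: "real \<Rightarrow> real \<Rightarrow> real \<Rightarrow> nat filter" where
  "admissible_filter R \<mu> l = inf sequentially (principal (admissible_lengths R \<mu> l))"

text \<open>Without infinitely many admissible lengths (e.g. for irrational \<open>R\<close>) the filter is trivial
  and every real number would be a limit; no growth rate is assigned in that case.\<close>

definition has_growth_rate :: "real \<Rightarrow> real \<Rightarrow> real \<Rightarrow> real \<Rightarrow> bool" where
  "has_growth_rate R \<mu> l \<sigma> \<longleftrightarrow>
     infinite (admissible_lengths R \<mu> l) \<and>
     (growth_seq R \<mu> l \<longlongrightarrow> \<sigma>) (admissible_filter R \<mu> l)"

lemma bij_betw_bit_mat:
  "bij_betw (\<lambda>f. mat m n f) (({..<m} \<times> {..<n}) \<rightarrow>\<^sub>E (UNIV :: bit set)) (carrier_mat m n)"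
proof (rule bij_betw_byWitness[where f' = "\<lambda>A. restrict (\<lambda>ij. A $$ ij) ({..<m} \<times> {..<n})"])
  show "\<forall>f\<in>({..<m} \<times> {..<n}) \<rightarrow>\<^sub>E (UNIV :: bit set).
          restrict (\<lambda>ij. mat m n f $$ ij) ({..<m} \<times> {..<n}) = f"
  proof
    fix f assume f: "f \<in> ({..<m} \<times> {..<n}) \<rightarrow>\<^sub>E (UNIV :: bit set)"
    show "restrict (\<lambda>ij. mat m n f $$ ij) ({..<m} \<times> {..<n}) = f"
    proof
      fix ij show "restrict (\<lambda>ij. mat m n f $$ ij) ({..<m} \<times> {..<n}) ij = f ij"
        using f by (cases ij) (auto simp: restrict_def PiE_def extensional_def)
    qed
  qed
next
  show "(\<lambda>A. restrict (\<lambda>ij. A $$ ij) ({..<m} \<times> {..<n})) ` carrier_mat m n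
          \<subseteq> ({..<m} \<times> {..<n}) \<rightarrow>\<^sub>E (UNIV :: bit set)"
    by (intro image_subsetI restrict_PiE[THEN iffD2]) simp
qed (auto intro!: eq_matI)

lemma UNIV_bit: "(UNIV :: bit set) = {0, 1}"
  by (metis (mono_tags, lifting) UNIV_eq_I bit_not_zero_iff insert_iff)

lemma CARD_bit: "card (UNIV :: bit set) = 2"
  by (simp add: UNIV_bit)

lemma finite_UNIV_bit: "finite (UNIV :: bit set)"
  by (simp add: UNIV_bit)

lemma finite_carrier_bit_mat: "finite (carrier_mat m n :: bit mat set)"
proof -
  have "finite (({..<m} \<times> {..<n}) \<rightarrow>\<^sub>E (UNIV :: bit set))"
    by (intro finite_PiE) (auto simp: UNIV_bit)
  then show ?thesis
    using bij_betw_finite[OF bij_betw_bit_mat] by blast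
qed

lemma card_carrier_bit_mat: "card (carrier_mat m n :: bit mat set) = 2 ^ (m * n)"
proof -
  have "card (({..<m} \<times> {..<n}) \<rightarrow>\<^sub>E (UNIV :: bit set)) = 2 ^ (m * n)"
    using CARD_bit by (subst card_PiE) (simp_all add: card_cartesian_product)
  then show ?thesis
    using bij_betw_same_card[OF bij_betw_bit_mat] by metis
qed

lemma set_coeff_vecs: "set (coeff_vecs L) = {c. length c = L \<and> c \<noteq> replicate L 0}"
proof -
  have "set c \<subseteq> {0, 1}" for c :: "bit list"
    using UNIV_bit by blast
  then show ?thesis
    by (auto simp: coeff_vecs_def set_n_lists)
qed

lemma set_rows_redundant_ext:
  "set (rows (redundant_ext L G)) =
     {block_comb L G b c | b c. b < dim_row G div L \<and> length c = L \<and> c \<noteq> replicate L 0}"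
proof -
  let ?rs = "concat (map (\<lambda>b. map (block_comb L G b) (coeff_vecs L)) [0..<dim_row G div L])"
  have "block_comb L G b c \<in> carrier_vec (dim_col G)" for b c
    by (simp add: block_comb_def)
  then have "set ?rs \<subseteq> carrier_vec (dim_col G)"
    by auto
  then have "set (rows (redundant_ext L G)) = set ?rs"
    by (simp only: redundant_ext_def rows_mat_of_rows)
  also have "\<dots> = {block_comb L G b c | b c. b < dim_row G div L \<and> c \<in> set (coeff_vecs L)}"
  proof (intro equalityI subsetI)
    fix v assume "v \<in> set ?rs"
    then obtain b c where "b < dim_row G div L" "c \<in> set (coeff_vecs L)" "v = block_comb L G b c"
      by auto
    then show "v \<in> {block_comb L G b c | b c. b < dim_row G div L \<and> c \<in> set (coeff_vecs L)}"
      unfolding mem_Collect_eq by metis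
  next
    fix v assume "v \<in> {block_comb L G b c | b c. b < dim_row G div L \<and> c \<in> set (coeff_vecs L)}"
    then show "v \<in> set ?rs"
      by auto
  qed
  finally show ?thesis
    by (simp only: set_coeff_vecs mem_Collect_eq)
qed

lemma length_coeff_vecs: "length (coeff_vecs L) = 2 ^ L - 1"
proof -
  have n_lists: "set (List.n_lists L [0, 1 :: bit]) = {c. set c \<subseteq> UNIV \<and> length c = L}"
    unfolding set_n_lists UNIV_bit by auto
  have "length (coeff_vecs L) = card (set (coeff_vecs L))"
    unfolding coeff_vecs_def
    by (rule distinct_card[symmetric]) (simp add: distinct_n_lists)
  also have "set (coeff_vecs L) = set (List.n_lists L [0, 1]) - {replicate L 0}"
    unfolding coeff_vecs_def by auto
  also have "card \<dots> = card (set (List.n_lists L [0, 1 :: bit])) - 1"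
    by (rule card_Diff_singleton) (simp add: n_lists)
  also have "card (set (List.n_lists L [0, 1 :: bit])) = 2 ^ L"
    unfolding n_lists card_lists_length_eq[OF finite_UNIV_bit] CARD_bit by (rule refl)
  finally show ?thesis .
qed

lemma redundant_ext_carrier:
  assumes "G \<in> carrier_mat m n"
  shows "redundant_ext L G \<in> carrier_mat ((2 ^ L - 1) * (m div L)) n"
proof (rule carrier_matI)
  show "dim_row (redundant_ext L G) = (2 ^ L - 1) * (m div L)"
    using assms
    by (simp add: redundant_ext_def length_concat comp_def length_coeff_vecs sum_list_triv
        mult.commute)
  show "dim_col (redundant_ext L G) = n"
    using assms by (simp add: redundant_ext_def)
qed

text \<open>The zero vector is always a stopping set vector. Hence the growth rate at \<open>l = 0\<close> is \<open>0\<close>,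
  which exceeds \<open>binary_entropy 0 - (1 - R) * (1 - 0 / \<mu>) = - (1 - R)\<close>: the upper
  bound needs \<open>l > 0\<close>.\<close>

lemma avg_num_stopping_0: "avg_num_stopping m n L 0 = 1"
proof -
  have zero: "int_inner h (0\<^sub>v k) = 0" for h k
    unfolding int_inner_def by (rule sum.neutral) simp
  have "num_stopping 0 M = 1" for M
  proof -
    have "{x. stopping_set_vec M x \<and> hamming_weight x = 0} = {0\<^sub>v (dim_col M)}"
    proof (intro equalityI subsetI)
      fix x :: "bit vec" assume "x \<in> {x. stopping_set_vec M x \<and> hamming_weight x = 0}"
      then show "x \<in> {0\<^sub>v (dim_col M)}"
        by (auto simp: stopping_set_vec_def hamming_weight_def intro!: eq_vecI)
    next
      fix x :: "bit vec" assume "x \<in> {0\<^sub>v (dim_col M)}"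
      then show "x \<in> {x. stopping_set_vec M x \<and> hamming_weight x = 0}"
        by (auto simp: stopping_set_vec_def hamming_weight_def zero)
    qed
    then show ?thesis
      by (simp add: num_stopping_def)
  qed
  then show ?thesis
    by (simp add: avg_num_stopping_def card_carrier_bit_mat)
qed

lemma growth_rate_weight_0:
  assumes "infinite (admissible_lengths R \<mu> 0)"
  shows "has_growth_rate R \<mu> 0 0"
proof -
  have "growth_seq R \<mu> 0 = (\<lambda>_. 0)"
    by (simp add: fun_eq_iff growth_seq_def avg_num_stopping_0)
  then show ?thesis
    using assms by (simp add: has_growth_rate_def)
qed

end

theory Submission
  imports Defs
begin

text \<open>Let \<open>x\<close> be a stopping set vector of weight \<open>w > 0\<close> and let \<open>j\<close> be in its support. No
  combination of the rows of a block restricts to the \<open>j\<close>-th unit vector on the support, so by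
  duality some \<open>y\<close> supported there with \<open>y\<^sub>j = 1\<close> is orthogonal to all \<open>L\<close> rows. A union bound over
  at most \<open>2\<^sup>w\<close> such \<open>y\<close>, each orthogonal with probability \<open>2\<^sup>-\<^sup>L\<close>, independently for the
  \<open>k = (1 - R) / \<mu>\<close> blocks, bounds the average number of stopping set vectors by
  \<open>(n choose w) * 2\<^sup>k\<^sup>(\<^sup>w\<^sup>-\<^sup>L\<^sup>)\<close>, and the entropy bound on the binomial coefficient gives the claim.\<close>

section \<open>Supports and counting of binary vectors\<close>

definition vec_support :: "bit vec \<Rightarrow> nat set" where
  "vec_support x = {i. i < dim_vec x \<and> x $ i \<noteq> 0}"

lemma hamming_weight_eq_card_support: "hamming_weight x = card (vec_support x)"
  by (simp add: hamming_weight_def vec_support_def)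

text \<open>A binary vector is the indicator of its support, so counting vectors reduces to counting
  sets.\<close>

lemma bij_betw_vec_support:
  assumes "A \<subseteq> {..<n}"
  shows "bij_betw vec_support {y \<in> carrier_vec n. vec_support y \<subseteq> A} (Pow A)"
proof (rule bij_betw_byWitness[where f' = "\<lambda>S. vec n (\<lambda>i. of_bool (i \<in> S))"])
  show "\<forall>y \<in> {y \<in> carrier_vec n. vec_support y \<subseteq> A}.
      vec n (\<lambda>i. of_bool (i \<in> vec_support y)) = y"
    by (auto simp: vec_support_def intro!: eq_vecI)
  show "\<forall>S \<in> Pow A. vec_support (vec n (\<lambda>i. of_bool (i \<in> S))) = S"
    using assms by (auto simp: vec_support_def)
  then show "(\<lambda>S. vec n (\<lambda>i. of_bool (i \<in> S))) ` Pow A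
      \<subseteq> {y \<in> carrier_vec n. vec_support y \<subseteq> A}"
    by auto
qed auto

lemma vec_support_subset: "x \<in> carrier_vec n \<Longrightarrow> vec_support x \<subseteq> {..<n}"
  by (auto simp: vec_support_def)

lemma finite_vec_support [simp]: "finite (vec_support x)"
  by (simp add: vec_support_def)

lemma
  assumes "A \<subseteq> {..<n}"
  shows card_vec_support_subset: "card {y \<in> carrier_vec n. vec_support y \<subseteq> A} = 2 ^ card A"
    and finite_vec_support_subset: "finite {y \<in> carrier_vec n. vec_support y \<subseteq> A}"
proof -
  have A: "finite A"
    using assms finite_subset by blast
  show "card {y \<in> carrier_vec n. vec_support y \<subseteq> A} = 2 ^ card A"
    using bij_betw_same_card[OF bij_betw_vec_support[OF assms]] A by (simp add: card_Pow)
  show "finite {y \<in> carrier_vec n. vec_support y \<subseteq> A}"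
    using bij_betw_finite[OF bij_betw_vec_support[OF assms]] A by simp
qed

lemma carrier_vec_eq_support: "carrier_vec n = {y \<in> carrier_vec n. vec_support y \<subseteq> {..<n}}"
  using vec_support_subset by blast

lemma card_carrier_bit_vec: "card (carrier_vec n :: bit vec set) = 2 ^ n"
  using card_vec_support_subset[of "{..<n}" n] carrier_vec_eq_support[of n] by simp

lemma finite_carrier_bit_vec: "finite (carrier_vec n :: bit vec set)"
  using finite_vec_support_subset[of "{..<n}" n] carrier_vec_eq_support[of n] by simp

lemma card_hamming_weight_le: "card {x \<in> carrier_vec n. hamming_weight x = w} \<le> n choose w"
proof -
  have "inj_on vec_support {x \<in> carrier_vec n. hamming_weight x = w}"
    using bij_betw_imp_inj_on[OF bij_betw_vec_support[of "{..<n}" n]] vec_support_subset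
    by (auto simp: inj_on_def)
  moreover have "vec_support ` {x \<in> carrier_vec n. hamming_weight x = w}
      \<subseteq> {S. S \<subseteq> {..<n} \<and> card S = w}"
    using vec_support_subset by (auto simp: hamming_weight_eq_card_support)
  ultimately have "card {x \<in> carrier_vec n. hamming_weight x = w}
      \<le> card {S. S \<subseteq> {..<n} \<and> card S = w}"
    by (intro card_inj_on_le) (auto intro: finite_subset[of _ "Pow {..<n}"])
  then show ?thesis
    by (simp add: n_subsets)
qed

section \<open>Duality for functionals over the two-element field\<close>

text \<open>Induction on \<open>L\<close>: on the kernel of the last functional, \<open>g\<close> is
  a combination of the others, and one coefficient for the last functional corrects it elsewhere.
  Over \<open>bit\<close>, additivity is linearity, so closure under addition is the only structure
  asked of \<open>S\<close>.\<close>

lemma additive_bit_functional_in_span: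
  fixes f :: "nat \<Rightarrow> 'a::plus \<Rightarrow> bit"
  assumes "\<And>x y. x \<in> S \<Longrightarrow> y \<in> S \<Longrightarrow> x + y \<in> S"
    and "\<And>k x y. k < L \<Longrightarrow> x \<in> S \<Longrightarrow> y \<in> S \<Longrightarrow> f k (x + y) = f k x + f k y"
    and "\<And>x y. x \<in> S \<Longrightarrow> y \<in> S \<Longrightarrow> g (x + y) = g x + g y"
    and "\<And>x. x \<in> S \<Longrightarrow> \<forall>k<L. f k x = 0 \<Longrightarrow> g x = 0"
  shows "\<exists>c. length c = L \<and> (\<forall>x\<in>S. g x = (\<Sum>k<L. c ! k * f k x))"
  using assms
proof (induction L arbitrary: S)
  case 0
  then show ?case by auto
next
  case (Suc L)
  let ?S = "{x \<in> S. f L x = 0}"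
  have "\<exists>c. length c = L \<and> (\<forall>x\<in>?S. g x = (\<Sum>k<L. c ! k * f k x))"
  proof (rule Suc.IH)
    show "g x = 0" if "x \<in> ?S" "\<forall>k<L. f k x = 0" for x
      using Suc.prems(4)[of x] that by (auto simp: less_Suc_eq)
  qed (use Suc.prems in auto)
  then obtain c where c: "length c = L" "\<And>x. x \<in> ?S \<Longrightarrow> g x = (\<Sum>k<L. c ! k * f k x)"
    by blast
  have c': "(\<Sum>k<Suc L. (c @ [a]) ! k * f k x) = (\<Sum>k<L. c ! k * f k x) + a * f L x" for a x
    using c(1) by (simp add: nth_append)
  show ?case
  proof (cases "\<exists>v\<in>S. f L v = 1")
    case False
    then have "\<forall>x\<in>S. g x = (\<Sum>k<Suc L. (c @ [0]) ! k * f k x)"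
      unfolding c' using c(2) by (auto simp: bit_not_one_iff)
    then show ?thesis
      using c(1) by (intro exI[of _ "c @ [0]"]) simp
  next
    case True
    then obtain v where v: "v \<in> S" "f L v = 1" by blast
    \<comment> \<open>The error at \<open>v\<close> of the combination found on the kernel; in
      characteristic 2, \<open>+\<close> acts as subtraction.\<close>
    define a where "a = g v + (\<Sum>k<L. c ! k * f k v)"
    have "g x = (\<Sum>k<Suc L. (c @ [a]) ! k * f k x)" if x: "x \<in> S" for x
    proof (cases "f L x = 0")
      case True
      then show ?thesis unfolding c' using c(2) x by simp
    next
      case False
      then have f: "f L x = 1" by (simp add: bit_not_zero_iff)
      \<comment> \<open>Both values are 1, so the sum lies in the kernel \<open>?S\<close>, where
        the combination \<open>c\<close> is valid.\<close>
      have "f L (x + v) = 0"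
        using Suc.prems(2)[of L x v] f v x by simp
      then have "g (x + v) = (\<Sum>k<L. c ! k * f k (x + v))"
        using c(2) Suc.prems(1) v x by simp
      also have "\<dots> = (\<Sum>k<L. c ! k * f k x + c ! k * f k v)"
        using Suc.prems(2)[OF _ x v(1)]
        by (intro sum.cong refl) (simp only: lessThan_iff less_SucI distrib_left)
      also have "\<dots> = (\<Sum>k<L. c ! k * f k x) + (\<Sum>k<L. c ! k * f k v)"
        by (rule sum.distrib)
      finally have "g x + g v = (\<Sum>k<L. c ! k * f k x) + (\<Sum>k<L. c ! k * f k v)"
        using Suc.prems(3) v x by simp
      then have "g x = (\<Sum>k<L. c ! k * f k x) + a"
        unfolding a_def
        by (cases "g x"; cases "g v"; cases "\<Sum>k<L. c ! k * f k x";
            cases "\<Sum>k<L. c ! k * f k v") auto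
      then show ?thesis
        unfolding c' using f by simp
    qed
    then show ?thesis
      using c(1) by (intro exI[of _ "c @ [a]"]) simp
  qed
qed

section \<open>Counting matrices under orthogonality constraints\<close>

text \<open>Adding a unit vector at a position where \<open>z\<close> is 1 flips the inner product,
  so the orthogonal vectors and their translates are disjoint and equinumerous.\<close>

lemma card_orthogonal_le:
  fixes z :: "bit vec"
  assumes z: "z \<in> carrier_vec n" "z \<noteq> 0\<^sub>v n"
  shows "card {v \<in> carrier_vec n. v \<bullet> z = 0} * 2 \<le> 2 ^ n"
proof -
  obtain j where j: "j < n" "z $ j = 1"
    using z by (metis bit_not_zero_iff carrier_vecD eq_vecI index_zero_vec)
  let ?H = "{v \<in> carrier_vec n. v \<bullet> z = 0}"
  let ?t = "\<lambda>v. v + unit_vec n j"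
  have H: "finite ?H" using finite_carrier_bit_vec by simp
  have inj: "inj_on ?t ?H"
  proof (rule inj_onI)
    fix u v assume uv: "u \<in> ?H" "v \<in> ?H" "?t u = ?t v"
    show "u = v"
    proof (rule eq_vecI)
      fix i assume i: "i < dim_vec v"
      then have "i < dim_vec (unit_vec n j :: bit vec)" using uv(2) by auto
      then have "u $ i + unit_vec n j $ i = v $ i + unit_vec n j $ i"
        using arg_cong[OF uv(3), of "\<lambda>v. v $ i"] by (simp only: index_add_vec(1))
      then show "u $ i = v $ i" by (rule add_right_imp_eq)
    qed (use uv in auto)
  qed
  have t: "?t v \<bullet> z = 1" if "v \<in> ?H" for v
    using that z j by (simp add: add_scalar_prod_distrib[of _ n])
  have "?t v \<notin> ?H" if "v \<in> ?H" for v
    using t[OF that] by simp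
  then have "?H \<inter> ?t ` ?H = {}"
    by blast
  with inj have "card (?H \<union> ?t ` ?H) = card ?H * 2"
    using H by (simp add: card_Un_disjoint card_image)
  moreover have "card (?H \<union> ?t ` ?H) \<le> card (carrier_vec n :: bit vec set)"
    by (intro card_mono finite_carrier_bit_vec) auto
  ultimately show ?thesis
    by (simp add: card_carrier_bit_vec)
qed

text \<open>The constraints concern separate rows, so the count factors, and each row keeps at most
  half of its \<open>2 ^ n\<close> choices. The vector \<open>z r\<close> may change with the row
  because different blocks will get different vectors.\<close>

lemma card_rows_orthogonal_le:
  fixes z :: "nat \<Rightarrow> bit vec"
  assumes "\<And>r. r < m \<Longrightarrow> z r \<in> carrier_vec n" "\<And>r. r < m \<Longrightarrow> z r \<noteq> 0\<^sub>v n"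
  shows "card {G \<in> carrier_mat m n. \<forall>r<m. row G r \<bullet> z r = 0} * 2 ^ m \<le> 2 ^ (m * n)"
proof -
  let ?A = "{G \<in> carrier_mat m n. \<forall>r<m. row G r \<bullet> z r = 0}"
  let ?H = "\<lambda>r. {v \<in> carrier_vec n. v \<bullet> z r = 0}"
  let ?P = "Pi\<^sub>E {..<m} ?H"
  have "inj_on (\<lambda>G. restrict (row G) {..<m}) ?A"
  proof (rule inj_onI)
    fix G K assume GK: "G \<in> ?A" "K \<in> ?A" "restrict (row G) {..<m} = restrict (row K) {..<m}"
    have "row G r = row K r" if "r < m" for r
      using fun_cong[OF GK(3), of r] that by simp
    then show "G = K"
      using GK by (intro eq_rowI) auto
  qed
  moreover have "(\<lambda>G. restrict (row G) {..<m}) ` ?A \<subseteq> ?P"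
    by (auto simp: restrict_PiE_iff)
  moreover have "finite ?P"
    using finite_carrier_bit_vec by (intro finite_PiE) auto
  ultimately have "card ?A \<le> card ?P"
    by (rule card_inj_on_le)
  also have "\<dots> = (\<Prod>r<m. card (?H r))"
    by (simp add: card_PiE)
  finally have "card ?A * 2 ^ m \<le> (\<Prod>r<m. card (?H r)) * 2 ^ m"
    by simp
  also have "\<dots> = (\<Prod>r<m. card (?H r) * 2)"
    by (simp add: prod.distrib)
  also have "\<dots> \<le> (\<Prod>r<m. 2 ^ n)"
    using assms by (intro prod_mono conjI card_orthogonal_le) auto
  also have "\<dots> = 2 ^ (m * n)"
    by (simp add: power_mult[symmetric] mult.commute)
  finally show ?thesis .
qed

section \<open>Stopping sets and kernels of blocks\<close>

text \<open>Serves two cases: a zero coefficient vector, and the zero matrix.\<close>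

lemma block_comb_index_eq_0:
  assumes "\<And>k. k < L \<Longrightarrow> c ! k = 0 \<or> G $$ (b * L + k, j) = 0" "j < dim_col G"
  shows "block_comb L G b c $ j = 0"
proof -
  have "(\<Sum>k<L. c ! k * G $$ (b * L + k, j)) = 0"
    by (rule sum.neutral) (use assms(1) in auto)
  then show ?thesis
    using assms(2) by (simp only: block_comb_def index_vec)
qed

lemma block_row_less:
  fixes b L m k :: nat
  assumes "b < m div L" "k < L"
  shows "b * L + k < m"
proof -
  have "b * L + k < Suc b * L" using assms(2) by simp
  also have "\<dots> \<le> m div L * L" using assms(1) by (intro mult_right_mono) auto
  also have "\<dots> \<le> m" by simp
  finally show ?thesis .
qed

text \<open>Otherwise the coordinate \<open>y $ j\<close> vanishes on the common kernel of the block
  rows among the vectors supported in \<open>vec_support x\<close>. By duality it is a combination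
  of these rows there, and that combination meets \<open>x\<close> exactly in position
  \<open>j\<close>.\<close>

lemma stopping_set_block_kernel:
  assumes G: "G \<in> carrier_mat m n" and b: "b < m div L"
    and x: "stopping_set_vec (redundant_ext L G) x" and j: "j \<in> vec_support x"
  shows "\<exists>y\<in>carrier_vec n. vec_support y \<subseteq> vec_support x \<and> y $ j = 1 \<and>
    (\<forall>r<L. row G (b * L + r) \<bullet> y = 0)"
proof (rule ccontr)
  assume no_kernel: "\<not> ?thesis"
  have dimx: "dim_vec x = n"
    using x redundant_ext_carrier[OF G, of L] by (simp add: stopping_set_vec_def)
  then have jn: "j < n" using j by (simp add: vec_support_def)
  let ?S = "{y \<in> carrier_vec n. vec_support y \<subseteq> vec_support x}"
  have add: "(row G (b * L + r) \<bullet> (u + v)) = row G (b * L + r) \<bullet> u + row G (b * L + r) \<bullet> v"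
    if "u \<in> carrier_vec n" "v \<in> carrier_vec n" for r u v
    using G that by (intro scalar_prod_add_distrib[of _ n]) auto
  have "\<exists>c. length c = L \<and> (\<forall>y\<in>?S. y $ j = (\<Sum>k<L. c ! k * (row G (b * L + k) \<bullet> y)))"
  proof (rule additive_bit_functional_in_span)
    show "u + v \<in> ?S" if "u \<in> ?S" "v \<in> ?S" for u v
      using that by (fastforce simp: vec_support_def)
    show "y $ j = 0" if "y \<in> ?S" "\<forall>k<L. row G (b * L + k) \<bullet> y = 0" for y
      using no_kernel that by (auto simp: bit_not_one_iff)
  qed (use jn add in auto)
  then obtain c where c: "length c = L"
    "\<And>y. y \<in> ?S \<Longrightarrow> y $ j = (\<Sum>k<L. c ! k * (row G (b * L + k) \<bullet> y))"
    by blast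
  have row: "b * L + k < m" if "k < L" for k
    using block_row_less b that .
  \<comment> \<open>Evaluating the functional identity at unit vectors reads off the entries of the
    combination on the support.\<close>
  have comb: "block_comb L G b c $ i = of_bool (i = j)" if i: "i \<in> vec_support x" for i
  proof -
    have "i < n" using i dimx by (simp add: vec_support_def)
    moreover have "vec_support (unit_vec n i) \<subseteq> vec_support x"
      using i by (auto simp: vec_support_def unit_vec_def split: if_splits)
    then have "unit_vec n i $ j = (\<Sum>k<L. c ! k * (row G (b * L + k) \<bullet> unit_vec n i))"
      by (intro c(2)) simp
    ultimately show ?thesis
      using G jn row by (auto simp: block_comb_def)
  qed
  have "int_inner (block_comb L G b c) x = (\<Sum>i<n. of_bool (i = j))"
    unfolding int_inner_def dimx
  proof (rule sum.cong[OF refl])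
    fix i assume "i \<in> {..<n}"
    then show "of_bit (block_comb L G b c $ i) * of_bit (x $ i) = (of_bool (i = j) :: int)"
      using comb[of i] j dimx by (cases "x $ i") (auto simp: vec_support_def)
  qed
  also have "\<dots> = 1" using jn by simp
  finally have "int_inner (block_comb L G b c) x = 1" .
  \<comment> \<open>The extension contains only combinations with nonzero coefficients; here the
    entry 1 at \<open>j\<close> rules out \<open>c = 0\<close>.\<close>
  moreover have "c \<noteq> replicate L 0"
    using comb[OF j] jn G block_comb_index_eq_0[of L c G b j] by auto
  then have "block_comb L G b c \<in> set (rows (redundant_ext L G))"
    unfolding set_rows_redundant_ext using b c(1) G by auto
  ultimately show False
    using x by (auto simp: stopping_set_vec_def)
qed

text \<open>Choosing one kernel vector per block covers the event by \<open>card Y ^ k\<close>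
  families of matrices, each with one linear constraint per row.\<close>

lemma card_stopping_le:
  assumes x: "x \<in> carrier_vec n" "hamming_weight x = w" and w: "0 < w" and L: "0 < L"
  shows "card {G \<in> carrier_mat (k * L) n. stopping_set_vec (redundant_ext L G) x} * 2 ^ (k * L)
    \<le> 2 ^ (w * k) * 2 ^ (k * L * n)"
proof -
  let ?m = "k * L"
  obtain j where j: "j \<in> vec_support x"
    using x w unfolding hamming_weight_eq_card_support by (metis card_gt_0_iff ex_in_conv)
  have jn: "j < n" using j x by (auto simp: vec_support_def)
  \<comment> \<open>The condition \<open>y $ j = 1\<close> keeps out the zero vector, which is
    orthogonal to everything. Bounding \<open>card Y\<close> by \<open>2 ^ w\<close> loses a factor
    2 per block, hence \<open>2 ^ k\<close> in all, which does not grow with \<open>n\<close> for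
    fixed \<open>k\<close>.\<close>
  define Y where "Y = {y \<in> carrier_vec n. vec_support y \<subseteq> vec_support x \<and> y $ j = 1}"
  let ?Z = "{y \<in> carrier_vec n. vec_support y \<subseteq> vec_support x}"
  have Z: "finite ?Z" "card ?Z = 2 ^ w"
    using finite_vec_support_subset[OF vec_support_subset[OF x(1)]]
      card_vec_support_subset[OF vec_support_subset[OF x(1)]] x(2)
    by (simp_all add: hamming_weight_eq_card_support)
  have YZ: "Y \<subseteq> ?Z" by (auto simp: Y_def)
  have Y: "finite Y" "card Y \<le> 2 ^ w"
    using finite_subset[OF YZ Z(1)] card_mono[OF Z(1) YZ] Z(2) by auto
  \<comment> \<open>A function in \<open>?F\<close> picks one vector per block, and
    \<open>r div L\<close> is the block of row \<open>r\<close>.\<close>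
  let ?F = "{..<k} \<rightarrow>\<^sub>E Y"
  let ?K = "\<lambda>y. {G \<in> carrier_mat ?m n. \<forall>r<?m. row G r \<bullet> y (r div L) = 0}"
  have F: "finite ?F" using Y by (intro finite_PiE) auto
  have "{G \<in> carrier_mat ?m n. stopping_set_vec (redundant_ext L G) x} \<subseteq> (\<Union>y\<in>?F. ?K y)"
  proof
    fix G assume "G \<in> {G \<in> carrier_mat ?m n. stopping_set_vec (redundant_ext L G) x}"
    then have G: "G \<in> carrier_mat ?m n" "stopping_set_vec (redundant_ext L G) x" by auto
    have "\<exists>y\<in>Y. \<forall>r<L. row G (b * L + r) \<bullet> y = 0" if "b < k" for b
      using stopping_set_block_kernel[OF G(1) _ G(2) j, of b] that L by (auto simp: Y_def)
    then obtain y where y: "\<And>b. b < k \<Longrightarrow> y b \<in> Y"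
      "\<And>b r. b < k \<Longrightarrow> r < L \<Longrightarrow> row G (b * L + r) \<bullet> y b = 0"
      by metis
    have "row G r \<bullet> y (r div L) = 0" if "r < ?m" for r
      using y(2)[of "r div L" "r mod L"] that L by (simp add: less_mult_imp_div_less)
    then have "G \<in> ?K (restrict y {..<k})"
      using G(1) L by (simp add: less_mult_imp_div_less)
    moreover have "restrict y {..<k} \<in> ?F"
      using y(1) by auto
    ultimately show "G \<in> (\<Union>y\<in>?F. ?K y)" by blast
  qed
  then have "card {G \<in> carrier_mat ?m n. stopping_set_vec (redundant_ext L G) x}
      \<le> card (\<Union>y\<in>?F. ?K y)"
    using F finite_carrier_bit_mat by (intro card_mono) auto
  also have "\<dots> \<le> (\<Sum>y\<in>?F. card (?K y))"
    by (rule card_UN_le[OF F])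
  finally have "card {G \<in> carrier_mat ?m n. stopping_set_vec (redundant_ext L G) x} * 2 ^ ?m
      \<le> (\<Sum>y\<in>?F. card (?K y) * 2 ^ ?m)"
    by (simp add: sum_distrib_right[symmetric])
  also have "\<dots> \<le> (\<Sum>y\<in>?F. 2 ^ (?m * n))"
  proof (intro sum_mono card_rows_orthogonal_le)
    fix y r assume "y \<in> ?F" "r < ?m"
    then have "y (r div L) \<in> Y"
      using PiE_mem[of y "{..<k}" "\<lambda>_. Y" "r div L"] by (simp add: less_mult_imp_div_less)
    then show "y (r div L) \<in> carrier_vec n" "y (r div L) \<noteq> 0\<^sub>v n"
      using jn by (auto simp: Y_def)
  qed
  also have "\<dots> = card Y ^ k * 2 ^ (?m * n)"
    by (simp add: card_PiE)
  also have "\<dots> \<le> (2 ^ w) ^ k * 2 ^ (?m * n)"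
    using Y(2) by (intro mult_right_mono power_mono) auto
  finally show ?thesis by (simp add: power_mult)
qed

section \<open>Bounds on the average number of stopping set vectors\<close>

text \<open>Every extension has \<open>n\<close> columns, so the vectors range over a set
  independent of \<open>G\<close>, which allows exchanging the sums over \<open>G\<close> and
  \<open>x\<close>.\<close>

lemma num_stopping_redundant_ext:
  assumes "G \<in> carrier_mat m n"
  shows "num_stopping w (redundant_ext L G) =
    card {x \<in> {x \<in> carrier_vec n. hamming_weight x = w}. stopping_set_vec (redundant_ext L G) x}"
  unfolding num_stopping_def
  using redundant_ext_carrier[OF assms, of L]
  by (intro arg_cong[where f = card]) (auto simp: stopping_set_vec_def)

text \<open>The trivial bound, to be used for \<open>l > \<mu>\<close>, where the union bound
  exceeds it.\<close>

lemma avg_num_stopping_le_choose: "avg_num_stopping m n L w \<le> real (n choose w)"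
proof -
  have "num_stopping w (redundant_ext L G) \<le> n choose w" if "G \<in> carrier_mat m n" for G
  proof -
    have "num_stopping w (redundant_ext L G) \<le> card {x \<in> carrier_vec n. hamming_weight x = w}"
      unfolding num_stopping_redundant_ext[OF that]
      using finite_carrier_bit_vec by (intro card_mono) auto
    then show ?thesis using card_hamming_weight_le le_trans by blast
  qed
  then have "(\<Sum>G\<in>carrier_mat m n. real (num_stopping w (redundant_ext L G)))
      \<le> (\<Sum>G\<in>(carrier_mat m n :: bit mat set). real (n choose w))"
    by (intro sum_mono) simp
  then show ?thesis
    by (simp add: avg_num_stopping_def card_carrier_bit_mat divide_le_eq mult.commute)
qed

text \<open>Exchanging the sums turns the average into a sum over \<open>x\<close> of the
  probability that \<open>x\<close> is a stopping set vector. The exponent is real because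
  \<open>w - L\<close> may be negative.\<close>

lemma avg_num_stopping_le:
  assumes "0 < w" "0 < L"
  shows "avg_num_stopping (k * L) n L w \<le> real (n choose w) * 2 powr (real k * (real w - real L))"
proof -
  let ?m = "k * L"
  let ?W = "{x \<in> carrier_vec n. hamming_weight x = w}"
  let ?Q = "\<lambda>x G. stopping_set_vec (redundant_ext L G) x"
  have W: "finite ?W" using finite_carrier_bit_vec by simp
  have fin: "finite (carrier_mat ?m n :: bit mat set)" by (rule finite_carrier_bit_mat)
  have bound: "card {G \<in> carrier_mat ?m n. ?Q x G} / 2 ^ (?m * n)
      \<le> 2 powr (real k * (real w - real L))" if "x \<in> ?W" for x
  proof -
    have "card {G \<in> carrier_mat ?m n. ?Q x G} * 2 ^ ?m \<le> 2 ^ (w * k) * 2 ^ (?m * n)"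
      using card_stopping_le[of x n w L k] that assms by blast
    then have "real (card {G \<in> carrier_mat ?m n. ?Q x G} * 2 ^ ?m)
        \<le> real (2 ^ (w * k) * 2 ^ (?m * n))"
      by (rule of_nat_mono)
    then have "card {G \<in> carrier_mat ?m n. ?Q x G} / 2 ^ (?m * n) \<le> (2 ^ (w * k) / 2 ^ ?m :: real)"
      by (simp add: field_simps)
    also have "\<dots> = 2 powr (real (w * k) - real ?m)"
      by (simp only: powr_diff powr_realpow[symmetric] zero_less_numeral)
    also have "real (w * k) - real ?m = real k * (real w - real L)"
      by (simp add: algebra_simps)
    finally show ?thesis .
  qed
  have "(\<Sum>G\<in>carrier_mat ?m n. real (num_stopping w (redundant_ext L G)))
      = (\<Sum>G\<in>carrier_mat ?m n. \<Sum>x\<in>?W. of_bool (?Q x G))"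
  proof (rule sum.cong[OF refl])
    fix G :: "bit mat" assume "G \<in> carrier_mat ?m n"
    then show "real (num_stopping w (redundant_ext L G)) = (\<Sum>x\<in>?W. of_bool (?Q x G))"
      using W by (simp only: num_stopping_redundant_ext sum_of_bool_eq Int_def mem_Collect_eq)
  qed
  also have "\<dots> = (\<Sum>x\<in>?W. \<Sum>G\<in>carrier_mat ?m n. of_bool (?Q x G))"
    by (rule sum.swap)
  also have "\<dots> = (\<Sum>x\<in>?W. real (card {G \<in> carrier_mat ?m n. ?Q x G}))"
    using fin by (simp only: sum_of_bool_eq Int_def mem_Collect_eq)
  finally have "avg_num_stopping ?m n L w
      = (\<Sum>x\<in>?W. card {G \<in> carrier_mat ?m n. ?Q x G} / 2 ^ (?m * n))"
    by (simp only: avg_num_stopping_def sum_divide_distrib)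
  also have "\<dots> \<le> (\<Sum>x\<in>?W. 2 powr (real k * (real w - real L)))"
    by (rule sum_mono) (rule bound)
  also have "\<dots> = real (card ?W) * 2 powr (real k * (real w - real L))"
    by simp
  also have "\<dots> \<le> real (n choose w) * 2 powr (real k * (real w - real L))"
    using card_hamming_weight_le by (intro mult_right_mono) auto
  finally show ?thesis .
qed

text \<open>Positivity matters because of the junk value \<open>log 2 0 = 0\<close>; the zero matrix contributes.\<close>

lemma avg_num_stopping_pos:
  assumes "w \<le> n"
  shows "0 < avg_num_stopping m n L w"
proof -
  let ?G = "0\<^sub>m m n :: bit mat"
  let ?x = "vec n (\<lambda>i. of_bool (i \<in> {..<w})) :: bit vec"
  have G: "?G \<in> carrier_mat m n" by simp
  have "vec_support ?x = {..<w}"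
    using assms by (auto simp: vec_support_def)
  then have weight: "hamming_weight ?x = w"
    by (simp add: hamming_weight_eq_card_support)
  have "int_inner h ?x = 0" if h: "h \<in> set (rows (redundant_ext L ?G))" for h
  proof -
    obtain b c where bc: "b < m div L" "h = block_comb L ?G b c"
      using h unfolding set_rows_redundant_ext by auto
    \<comment> \<open>Entries of the zero matrix are known to be 0 only at indices inside its
      dimensions.\<close>
    have "b * L + k < m" if "k < L" for k
      using block_row_less bc(1) that .
    then have "h $ i = 0" if "i < n" for i
      unfolding bc(2) using that by (intro block_comb_index_eq_0) auto
    then show ?thesis by (simp add: int_inner_def)
  qed
  then have "stopping_set_vec (redundant_ext L ?G) ?x"
    using redundant_ext_carrier[OF G, of L] by (auto simp: stopping_set_vec_def)
  then have "0 < num_stopping w (redundant_ext L ?G)"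
    using weight finite_carrier_bit_vec
    unfolding num_stopping_redundant_ext[OF G] by (subst card_gt_0_iff) auto
  then have "0 < (\<Sum>G\<in>carrier_mat m n. real (num_stopping w (redundant_ext L G)))"
    by (intro sum_pos2[OF finite_carrier_bit_mat G]) auto
  then show ?thesis
    by (simp add: avg_num_stopping_def)
qed

section \<open>Entropy bound and growth rate\<close>

text \<open>With \<open>p = w / n\<close>, the term of index \<open>w\<close> in the expansion of
  \<open>(p + (1 - p)) ^ n = 1\<close> is at most 1; taking its logarithm gives the claim.\<close>

lemma log_choose_le_binary_entropy:
  assumes "0 < w" "w \<le> n"
  shows "log 2 (real (n choose w)) \<le> real n * binary_entropy (real w / real n)"
\<comment> \<open>For \<open>w = n\<close> the factor \<open>1 - p\<close> is 0 and the logarithm of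
  the product cannot be split; both sides are then 0.\<close>
proof (cases "w = n")
  case True
  then show ?thesis using assms by (simp add: binary_entropy_def)
next
  case False
  define p where "p = real w / real n"
  have n: "0 < n" using assms by simp
  have p: "0 < p" "p < 1" using assms False by (auto simp: p_def)
  let ?C = "real (n choose w)"
  have "?C * p ^ w * (1 - p) ^ (n - w) \<le> (\<Sum>i\<le>n. real (n choose i) * p ^ i * (1 - p) ^ (n - i))"
    using p assms
    by (intro member_le_sum[of w "{..n}" "\<lambda>i. real (n choose i) * p ^ i * (1 - p) ^ (n - i)"]) auto
  also have "\<dots> = 1"
    using binomial_ring[of p "1 - p" n] by simp
  finally have le: "?C * p ^ w * (1 - p) ^ (n - w) \<le> 1" .
  have C: "0 < ?C" using assms by simp
  have "log 2 (?C * p ^ w * (1 - p) ^ (n - w)) \<le> log 2 1"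
    using le C p by (subst log_le_cancel_iff) auto
  then have "log 2 ?C + real w * log 2 p + real (n - w) * log 2 (1 - p) \<le> 0"
    using C p by (simp add: log_mult log_nat_power)
  moreover have "real w = real n * p" "real (n - w) = real n * (1 - p)"
    using n assms by (auto simp: p_def field_simps of_nat_diff)
  ultimately have "log 2 ?C \<le> real n * (- p * log 2 p - (1 - p) * log 2 (1 - p))"
    by (simp add: algebra_simps)
  then show ?thesis
    by (simp add: binary_entropy_def p_def)
qed

text \<open>The estimates carry no error terms, so the asymptotic bound already holds at every
  positive admissible length.\<close>

lemma growth_seq_le:
  fixes R \<mu> l :: real
  assumes R: "R < 1" and \<mu>: "0 < \<mu>" and int: "(1 - R) / \<mu> \<in> \<int>" and l: "0 < l" "l \<le> 1"
    and n: "n \<in> admissible_lengths R \<mu> l" "0 < n"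
  shows "growth_seq R \<mu> l n \<le>
    (if l \<le> \<mu> then binary_entropy l - (1 - R) * (1 - l / \<mu>) else binary_entropy l)"
proof -
  obtain m L w where mLw: "(1 - R) * real n = real m" "\<mu> * real n = real L" "l * real n = real w"
    using n(1) by (auto simp: admissible_lengths_def Nats_def)
  obtain k where k: "(1 - R) / \<mu> = real k"
  proof -
    have "(1 - R) / \<mu> \<in> \<nat>" using int R \<mu> by (simp add: Nats_altdef2)
    then show ?thesis using that by (auto simp: Nats_def)
  qed
  \<comment> \<open>The rows form exactly \<open>k\<close> blocks, and \<open>k\<close> does not
    depend on \<open>n\<close>.\<close>
  have "1 - R = real k * \<mu>"
    using k \<mu> by (simp add: field_simps)
  then have "real m = real (k * L)"
    using mLw(1,2) by (metis mult.assoc of_nat_mult)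
  then have m: "m = k * L" by (simp only: of_nat_eq_iff)
  have "0 < real L" "0 < real w" "real w \<le> real n"
    using mLw[symmetric] \<mu> l n(2) by simp_all
  then have L: "0 < L" and w: "0 < w" "w \<le> n" by simp_all
  have lw: "real w / real n = l"
    using mLw(3) n(2) by (simp add: field_simps)
  have growth: "growth_seq R \<mu> l n = log 2 (avg_num_stopping (k * L) n L w) / real n"
    unfolding growth_seq_def mLw m[symmetric] by simp
  have pos: "0 < avg_num_stopping (k * L) n L w"
    using w by (intro avg_num_stopping_pos)
  have entropy: "log 2 (real (n choose w)) \<le> real n * binary_entropy l"
    using log_choose_le_binary_entropy[OF w] lw by simp
  have C: "0 < real (n choose w)" using w by simp
  show ?thesis
  proof (cases "l \<le> \<mu>")
    case True
    have "log 2 (avg_num_stopping (k * L) n L w)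
        \<le> log 2 (real (n choose w) * 2 powr (real k * (real w - real L)))"
      using pos C avg_num_stopping_le[OF w(1) L] by (subst log_le_cancel_iff) auto
    also have "\<dots> = log 2 (real (n choose w)) + real k * (real w - real L)"
      using C by (simp add: log_mult)
    also have "\<dots> \<le> real n * binary_entropy l + real k * (real w - real L)"
      using entropy by simp
    \<comment> \<open>Here \<open>k = (1 - R) / \<mu>\<close> and
      \<open>w - L = n * (l - \<mu>)\<close>.\<close>
    also have "real k * (real w - real L) = - (real n * ((1 - R) * (1 - l / \<mu>)))"
      using \<mu> by (simp add: k[symmetric] mLw[symmetric] field_simps)
    finally have "log 2 (avg_num_stopping (k * L) n L w)
        \<le> (binary_entropy l - (1 - R) * (1 - l / \<mu>)) * real n"
      by (simp only: left_diff_distrib mult.commute[of "real n"] add_uminus_conv_diff)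
    then show ?thesis
      using n(2) True by (simp only: growth if_True divide_le_eq of_nat_0_less_iff)
  next
    case False
    \<comment> \<open>Now \<open>w > L\<close>, so the factor from the union bound would be larger
      than 1.\<close>
    have "log 2 (avg_num_stopping (k * L) n L w) \<le> log 2 (real (n choose w))"
      using pos C avg_num_stopping_le_choose by (subst log_le_cancel_iff) auto
    then show ?thesis
      using n(2) False entropy by (simp add: growth divide_le_eq mult.commute)
  qed
qed

text \<open>Existence of the limit is not established: the first conjunct bounds any growth rate,
  the second bounds the upper limit even if there is none. The case \<open>l = 0\<close> is excluded
  because the growth rate there is 0 by \<open>growth_rate_weight_0\<close>, while the formula gives
  \<open>- (1 - R)\<close>.\<close>

theorem corollary2:
  fixes R \<mu> l :: real
  assumes "0 < R" and "R < 1"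
    and "0 < \<mu>" and "\<mu> \<le> 1 - R" and "(1 - R) / \<mu> \<in> \<int>"
    and "0 < l" and "l \<le> 1"
  shows "let B = (if l \<le> \<mu> then binary_entropy l - (1 - R) * (1 - l / \<mu>) else binary_entropy l)
         in (\<forall>\<sigma>. has_growth_rate R \<mu> l \<sigma> \<longrightarrow> \<sigma> \<le> B) \<and>
            Limsup (admissible_filter R \<mu> l) (\<lambda>n. ereal (growth_seq R \<mu> l n)) \<le> ereal B"
proof -
  define B where
    "B = (if l \<le> \<mu> then binary_entropy l - (1 - R) * (1 - l / \<mu>) else binary_entropy l)"
  \<comment> \<open>Length 0 is admissible but not covered by \<open>growth_seq_le\<close>; passing
    to large \<open>n\<close> discards it.\<close>
  have ev: "\<forall>\<^sub>F n in admissible_filter R \<mu> l. growth_seq R \<mu> l n \<le> B"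
    unfolding admissible_filter_def eventually_inf_principal
    using eventually_gt_at_top[of "0::nat"]
    by eventually_elim (use growth_seq_le assms in \<open>auto simp: B_def\<close>)
  have "\<sigma> \<le> B" if "has_growth_rate R \<mu> l \<sigma>" for \<sigma>
  proof (rule tendsto_upperbound[OF _ ev])
    show "(growth_seq R \<mu> l \<longlongrightarrow> \<sigma>) (admissible_filter R \<mu> l)"
      using that by (simp add: has_growth_rate_def)
    \<comment> \<open>Infinitely many admissible lengths make the filter nontrivial, as is required
      for the bound to pass to the limit.\<close>
    have "frequently (\<lambda>n. n \<in> admissible_lengths R \<mu> l) sequentially"
      using that unfolding has_growth_rate_def cofinite_eq_sequentially[symmetric]
      by (simp add: frequently_cofinite)
    then show "admissible_filter R \<mu> l \<noteq> bot"
      by (simp add: admissible_filter_def trivial_limit_def eventually_inf_principal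
          frequently_def)
  qed
  moreover have "Limsup (admissible_filter R \<mu> l) (\<lambda>n. ereal (growth_seq R \<mu> l n)) \<le> ereal B"
    using ev by (intro Limsup_bounded) simp
  ultimately show ?thesis
    by (simp add: B_def[symmetric])
qed

end
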